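(* Let $b, c$ be non-zero integers such that: (1) $b \geq -2$; (2) $3 \nmid bc$; (3) if $b$ is even, then $c$ is even; (4) if $b$ is odd and there exist positive integers $x$ and $k$ with $2 \cdot 3^k < 2^x < 3^{k+1}$, $2^x \leq |b|$, and $(b \bmod 2^x) \equiv 0 \pmod 3$, then $c$ is even; (5) for every prime $p$ such that $2 \cdot 3^k < p < 3^{k+1}$ for some positive integer $k$, $p \leq |b|$, and $(b \bmod p) \equiv 0 \pmod 3$, we have $p \mid c$. Let $q_t(n) = 3c n^2 + bc n$ for $n \geq 0$. Then $D_{q_t}(n) = 3^{\lceil \log_3 n \rceil}$ for all integers $n \geq 1$.
   Context: For integers $a$ and $N \geq 1$, $a \bmod N$ denotes the least non-negative residue of $a$ modulo $N$. For an integer sequence $s = (s(i))_{i \geq 0}$ and an integer $n \geq 1$, the discriminator $D_s(n)$ is the least positive integer $m$ such that $s(0), \ldots, s(n-1)$ are pairwise incongruent modulo $m$. *)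

theory Defs
  imports Complex_Main "HOL-Computational_Algebra.Primes" "HOL-Number_Theory.Cong"
begin

(* LEAST is underspecified when no such m exists, i.e. when two of the terms coincide. *)
definition discriminator :: "(nat \<Rightarrow> int) \<Rightarrow> nat \<Rightarrow> nat" where
  "discriminator s n =
    (LEAST m. m > 0 \<and> (\<forall>i<n. \<forall>j<n. i \<noteq> j \<longrightarrow> \<not> [s i = s j] (mod int m)))"

end

theory Submission
  imports Defs
begin

text \<open>Write \<open>q(n) = 3cn\<^sup>2 + bcn\<close>, so that \<open>q(j) - q(i) = c(j - i)(3(i + j) + b)\<close>. Modulo a
power of 3 the first and last factors are units, hence \<open>q\<close> is injective modulo \<open>3\<^sup>k\<close> on
\<open>{0..<3\<^sup>k}\<close>. Conversely let \<open>K = 3\<^sup>k\<close> and \<open>m < 3K\<close>; a collision modulo \<open>m\<close> is needed among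
\<open>q(0), \<dots>, q(K)\<close>. With \<open>d = j - i\<close> and \<open>s = i + j\<close> this asks for \<open>d\<close>, \<open>s\<close> of equal parity with
\<open>1 \<le> d \<le> s \<le> 2K - d\<close> and \<open>m\<close> dividing \<open>cd(3s + b)\<close>. If \<open>3\<close> does not divide \<open>m\<close>, then every
\<open>s\<close> in \<open>{1..2K - 1}\<close> is admissible (with \<open>d = 1\<close> or \<open>d = 2\<close>), so \<open>m < 2K\<close> is easy. If \<open>m\<close> and
\<open>c\<close> are even, it suffices that \<open>m/2 < 2K\<close> divides \<open>3s + b\<close>. Otherwise, for \<open>m > 2K\<close>, the least
positive root \<open>s\<close> of \<open>3s + b\<close> modulo \<open>m\<close> is still small enough unless \<open>b mod m\<close> is divisible
by 3 and \<open>m \<le> \<bar>b\<bar>\<close>. In that case composite \<open>m\<close> are treated by splitting \<open>m\<close> between \<open>d\<close>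
and \<open>3s + b\<close>, and only the primes and the powers of 2 need a hypothesis on \<open>c\<close>.
If \<open>3\<close> divides \<open>m\<close>, its 3-part goes into \<open>d\<close>.\<close>

section \<open>Collisions and linear congruences\<close>

definition collision :: "int \<Rightarrow> int \<Rightarrow> int \<Rightarrow> int \<Rightarrow> bool" where
  "collision b c K m \<longleftrightarrow>
    (\<exists>i j. 0 \<le> i \<and> i < j \<and> j \<le> K \<and> m dvd c * (j - i) * (3 * (i + j) + b))"

lemma collisionI:
  assumes "1 \<le> d" "d \<le> s" "s + d \<le> 2 * K" "even (s - d)" "m dvd c * d * (3 * s + b)"
  shows "collision b c K m"
proof -
  obtain i where "s - d = 2 * i"
    using assms(4) by (elim evenE)
  then have "s = d + 2 * i"
    by simp
  then have "0 \<le> i" "i < i + d" "i + d \<le> K"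
    "m dvd c * ((i + d) - i) * (3 * (i + (i + d)) + b)"
    using assms by (auto simp: algebra_simps)
  then show ?thesis
    unfolding collision_def by blast
qed

lemma linear_root_in_interval:
  fixes a b w L :: int
  assumes "coprime a w" "w \<ge> 1"
  obtains s where "L \<le> s" "s < L + w" "w dvd a * s + b"
proof -
  obtain x where x: "[a * x = 1] (mod w)"
    using cong_solve_coprime_int[OF assms(1)] by blast
  define s where "s = L + (- b * x - L) mod w"
  have "[s = L + (- b * x - L)] (mod w)"
    unfolding s_def by (intro cong_add cong_refl) (simp add: cong_def)
  then have "[a * s + b = a * (- b * x) + b] (mod w)"
    by (intro cong_add cong_mult cong_refl) simp
  also have "a * (- b * x) + b = - b * (a * x) + b"
    by simp
  also have "[\<dots> = - b * 1 + b] (mod w)"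
    by (intro cong_add cong_mult cong_refl x)
  finally have "w dvd a * s + b"
    by (simp add: cong_0_iff)
  moreover have "L \<le> s" "s < L + w"
    using assms(2) by (simp_all add: s_def)
  ultimately show thesis
    using that by blast
qed

lemma coprime_3_iff: "coprime (3::int) m \<longleftrightarrow> \<not> 3 dvd m"
proof -
  have "prime (3::int)"
    by simp
  then show ?thesis
    by (metis coprime_commute coprime_absorb_left not_prime_unit prime_imp_coprime)
qed

section \<open>Collisions obtained by splitting the modulus\<close>

text \<open>Take \<open>d = u\<close> and let \<open>v\<close> divide \<open>3 * s + b\<close>. As
  \<open>d\<close> is odd, so is \<open>s = 2 * t + 1\<close>, which makes 6 the coefficient to
  invert modulo \<open>v\<close>. A window of length \<open>v\<close> for \<open>t\<close> starting
  at \<open>s = u\<close> gives \<open>s + d \<le> 2 * (u + v - 1)\<close>.\<close>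

lemma collision_odd_factor:
  assumes "odd u" "u \<ge> 1" "odd v" "v \<ge> 1" "\<not> 3 dvd v" "u + v \<le> K + 1"
  shows "collision b c K (u * v)"
proof -
  obtain h where h: "u = 2 * h + 1"
    using assms(1) by (elim oddE)
  have "coprime (2 * 3) v"
    using assms(3,5) by (simp only: coprime_mult_left_iff coprime_3_iff coprime_left_2_iff_odd) simp
  then have "coprime 6 v"
    by simp
  then obtain t where t: "h \<le> t" "t < h + v" "v dvd 6 * t + (3 + b)"
    using linear_root_in_interval assms(4) by blast
  have "3 * (2 * t + 1) + b = 6 * t + (3 + b)"
    by simp
  then have "u * v dvd c * u * (3 * (2 * t + 1) + b)"
    using t(3) by (metis dvd_mult mult.assoc mult_dvd_mono dvd_refl)
  then show ?thesis
    using assms h t by (intro collisionI[of u "2 * t + 1"]) auto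
qed

text \<open>An odd \<open>s\<close> is paired with \<open>d = F\<close> and an even one with \<open>d = 2F\<close>.\<close>

lemma collision_3_part:
  assumes "odd F" "F \<ge> 1" "w \<ge> 1" "\<not> 3 dvd w" "w \<le> 2 * K - 4 * F + 3"
  shows "collision b c K (F * w)"
proof -
  have "coprime 3 w"
    using assms(4) coprime_3_iff by blast
  \<comment> \<open>The odd left end forces an even \<open>s\<close> up to \<open>2 * F\<close>. At
    the right end \<open>s + 2 * F \<le> 2 * K + 1\<close>, which parity improves to
    \<open>2 * K\<close>.\<close>
  then obtain s where s: "2 * F - 1 \<le> s" "s < 2 * F - 1 + w" "w dvd 3 * s + b"
    using linear_root_in_interval assms(3) by blast
  show ?thesis
  proof (cases "even s")
    case True
    have "F * w dvd c * (2 * F) * (3 * s + b)"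
      using s(3) by (simp add: mult_dvd_mono)
    moreover have "2 * F \<le> s" "s + 2 * F \<le> 2 * K"
      using True s(1,2) assms(5) by presburger+
    ultimately show ?thesis
      using True assms by (intro collisionI[of "2 * F" s]) auto
  next
    case False
    have "F * w dvd c * F * (3 * s + b)"
      using s(3) by (simp add: mult_dvd_mono)
    then show ?thesis
      using False assms s by (intro collisionI[of F s]) auto
  qed
qed

lemma collision_small_root:
  assumes "1 \<le> s" "s \<le> 2 * K - 1" "m dvd c * (3 * s + b)"
  shows "collision b c K m"
proof (cases "even s")
  case True
  have "m dvd 2 * (c * (3 * s + b))"
    using assms(3) by (rule dvd_mult)
  then have "m dvd c * 2 * (3 * s + b)"
    by (simp only: mult_ac)
  moreover have "2 \<le> s" "s + 2 \<le> 2 * K"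
    using True assms(1,2) by presburger+
  ultimately show ?thesis
    using True by (intro collisionI[of 2 s]) auto
next
  case False
  then show ?thesis
    using assms by (intro collisionI[of 1 s]) auto
qed

lemma collision_coprime_3:
  fixes b m K :: int
  assumes "\<not> 3 dvd b" "b \<ge> -2" "b \<noteq> 0" "\<not> 3 dvd m" "m > 2" "m < 3 * K"
    and "\<not> (m \<le> \<bar>b\<bar> \<and> 3 dvd b mod m)" "even b \<longrightarrow> odd m" "odd K"
  shows "collision b c K m"
proof -
  define r where "r = b mod m"
  have r: "0 \<le> r" "r < m"
    using assms(5) by (simp_all add: r_def)
  have "m dvd b - r"
    by (simp add: r_def minus_mod_eq_mult_div)
  then obtain l where l: "b = r + m * l"
    by (metis dvdE diff_add_cancel add.commute)
  \<comment> \<open>The roots of \<open>3 * s + b\<close> modulo \<open>m\<close> are those of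
    \<open>3 * s + r\<close>. Since \<open>m\<close> is a unit modulo 3, one of
    \<open>m - r\<close>, \<open>2 * m - r\<close>, \<open>- r\<close> is divisible by 3; the first
    two give a root between 1 and \<open>2 * m / 3 < 2 * K\<close>.\<close>
  have "3 dvd m - r \<or> 3 dvd 2 * m - r \<or> 3 dvd r"
    using assms(4) by presburger
  then consider (r1) "3 dvd m - r" | (r2) "3 dvd 2 * m - r" | (r0) "3 dvd r"
    by blast
  then show ?thesis
  proof cases
    case r1
    then obtain s where s: "m - r = 3 * s"
      by (elim dvdE)
    have "3 * s + b = m * (l + 1)"
      using s l by (simp add: algebra_simps)
    then have "m dvd c * (3 * s + b)"
      by simp
    then show ?thesis
      using s r assms by (intro collision_small_root[of s]) auto
  next
    case r2
    then obtain s where s: "2 * m - r = 3 * s"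
      by (elim dvdE)
    have "3 * s + b = m * (l + 2)"
      using s l by (simp add: algebra_simps)
    then have "m dvd c * (3 * s + b)"
      by simp
    then show ?thesis
      using s r assms by (intro collision_small_root[of s]) auto
  next
    case r0
    \<comment> \<open>What survives is \<open>b = -1\<close> or \<open>b = -2\<close> with
      \<open>r = b + m\<close>, and the least positive root is
      \<open>(3 * m - r) / 3 = (2 * m - b) / 3\<close>.\<close>
    then have "m > \<bar>b\<bar>"
      using assms(7) by (auto simp: r_def)
    have "b < 0"
    proof (rule ccontr)
      assume "\<not> b < 0"
      then have "r = b"
        using \<open>m > \<bar>b\<bar>\<close> by (simp add: r_def)
      then show False
        using r0 assms(1) by simp
    qed
    then have "(b + m) mod m = b + m"
      using \<open>m > \<bar>b\<bar>\<close> by (intro mod_pos_pos_trivial) auto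
    then have "r = b + m"
      by (simp add: r_def)
    then have "3 dvd 2 * m - b"
      using r0 by presburger
    then obtain s where s: "2 * m - b = 3 * s"
      by (elim dvdE)
    have "m dvd c * (3 * s + b)"
      using s[symmetric] by simp
    moreover have "1 \<le> s"
      using s \<open>b < 0\<close> assms(5) by linarith
    moreover have "s \<le> 2 * K - 1"
    \<comment> \<open>For \<open>b = -2\<close> and \<open>m = 3 * K - 1\<close> the root would be
      \<open>2 * K\<close>, one too large; but that \<open>m\<close> is even, while an even
      \<open>b\<close> comes with an odd \<open>m\<close>.\<close>
    proof (cases "b = -2")
      case True
      then have "m \<noteq> 3 * K - 1"
        using assms(8,9) by auto
      then show ?thesis
        using s True assms(6) by linarith
    next
      case False
      then show ?thesis
        using s \<open>b < 0\<close> assms(2,6) by linarith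
    qed
    ultimately show ?thesis
      by (intro collision_small_root[of s]) auto
  qed
qed

text \<open>For odd \<open>b\<close> and odd \<open>s\<close> the number \<open>3 * s + b\<close> is
  even: with \<open>b = 2 * g + 1\<close> and \<open>s = 2 * t + 1\<close> it equals
  \<open>2 * (3 * t + 2 + g)\<close>. Hence one factor 2 is free and only \<open>A\<close> has to
  divide the linear form in \<open>t\<close>.\<close>

lemma collision_2_part:
  assumes "odd b" "odd u" "u \<ge> 1" "A \<ge> 1" "\<not> 3 dvd A" "u + A \<le> K + 1"
  shows "collision b c K (2 * A * u)"
proof -
  obtain h where h: "u = 2 * h + 1"
    using assms(2) by (elim oddE)
  obtain g where g: "b = 2 * g + 1"
    using assms(1) by (elim oddE)
  have "coprime 3 A"
    using assms(5) coprime_3_iff by blast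
  then obtain t where t: "h \<le> t" "t < h + A" "A dvd 3 * t + (2 + g)"
    using linear_root_in_interval assms(4) by blast
  have "c * u * (3 * (2 * t + 1) + b) = (c * (2 * u)) * (3 * t + (2 + g))"
    by (simp add: g algebra_simps)
  moreover have "2 * A * u = 2 * u * A"
    by simp
  ultimately have "2 * A * u dvd c * u * (3 * (2 * t + 1) + b)"
    using t(3) by (metis dvd_triv_right mult_dvd_mono)
  then show ?thesis
    using assms h t by (intro collisionI[of u "2 * t + 1"]) auto
qed

text \<open>The factor 2 comes from \<open>d = 2\<close> when the root \<open>s\<close> is even, and
  from \<open>3 * s + b\<close> when \<open>s\<close> is odd.\<close>

lemma collision_double_odd:
  assumes "odd b" "odd u" "u \<ge> 1" "\<not> 3 dvd u" "u \<le> 2 * K - 1"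
  shows "collision b c K (2 * u)"
proof -
  have "coprime 3 u"
    using assms(4) coprime_3_iff by blast
  then obtain s where s: "1 \<le> s" "s < 1 + u" "u dvd 3 * s + b"
    using linear_root_in_interval assms(3) by blast
  show ?thesis
  proof (cases "even s")
    case True
    have "2 * u dvd c * 2 * (3 * s + b)"
      using s(3) by (simp add: mult_dvd_mono)
    moreover have "2 \<le> s" "s + 2 \<le> 2 * K"
      using True s(1,2) assms(5) by presburger+
    ultimately show ?thesis
      using True by (intro collisionI[of 2 s]) auto
  next
    case False
    then have "even (3 * s + b)"
      using assms(1) by simp
    then have "2 * u dvd 3 * s + b"
      using s(3) assms(2) by (intro divides_mult) auto
    then show ?thesis
      using False s assms(5) by (intro collisionI[of 1 s]) auto
  qed
qed

section \<open>All moduli below \<open>3 ^ (k + 1)\<close>\<close>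

lemma odd_composite_factors:
  fixes m :: int
  assumes "m > 1" "odd m" "\<not> 3 dvd m" "\<not> prime m"
  obtains u v where "m = u * v" "u \<ge> 5" "v \<ge> 5" "odd u" "odd v" "\<not> 3 dvd v"
proof -
  obtain p where p: "prime p" "p dvd m"
    using assms(1) prime_divisor_exists[of m] by (auto simp: zdvd1_eq)
  then obtain v where v: "m = p * v"
    by (elim dvdE)
  have "p > 1"
    using p(1) prime_gt_1_int by blast
  then have "v > 0"
    using assms(1) v by (metis zero_less_mult_pos less_trans zero_less_one)
  have "v \<noteq> 1"
    using v p(1) assms(4) by auto
  have "odd p" "odd v" "\<not> 3 dvd p" "\<not> 3 dvd v"
    using v assms(2,3) by auto
  then have "p \<ge> 5" "v \<ge> 5"
    using \<open>p > 1\<close> \<open>v > 0\<close> \<open>v \<noteq> 1\<close> by presburger+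
  then show thesis
    using that v \<open>odd p\<close> \<open>odd v\<close> \<open>\<not> 3 dvd v\<close> by blast
qed

lemma collision_even:
  fixes b m :: int
  assumes "odd b" "m > 0" "even m" "\<not> 3 dvd m" "m < 3 * K" "\<nexists>x. m = 2 ^ x"
  shows "collision b c K m"
proof -
  define x where "x = multiplicity 2 m"
  define u where "u = m div 2 ^ x"
  have m: "m = 2 ^ x * u"
    unfolding u_def x_def by (simp add: multiplicity_dvd)
  have "\<not> 2 dvd m div 2 ^ multiplicity 2 m"
    by (rule multiplicity_decompose) (use assms(2) in auto)
  then have "odd u"
    by (simp add: u_def x_def)
  have "u > 0"
    using m assms(2) by (simp add: zero_less_mult_iff)
  have "u \<noteq> 1"
    using m assms(6) by auto
  have "\<not> 3 dvd u"
    using m assms(4) by auto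
  have "u \<ge> 5"
    using \<open>odd u\<close> \<open>u > 0\<close> \<open>u \<noteq> 1\<close> \<open>\<not> 3 dvd u\<close> by presburger
  have "x \<noteq> 0"
    using m \<open>odd u\<close> assms(3) by (intro notI) simp
  then obtain y where y: "x = Suc y"
    using not0_implies_Suc by blast
  define A :: int where "A = 2 ^ y"
  have mA: "m = 2 * A * u"
    by (simp add: m y A_def)
  have "A \<ge> 1"
    by (simp add: A_def)
  show ?thesis
  proof (cases "A = 1")
    case True
    then show ?thesis
      using collision_double_odd[of b u K c] assms mA \<open>odd u\<close> \<open>u > 0\<close> \<open>\<not> 3 dvd u\<close> by simp
  next
    case False
    then have "A \<ge> 2"
      using \<open>A \<ge> 1\<close> by simp
    \<comment> \<open>A product of factors bounded below controls their sum, so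
      \<open>2 * A * u < 3 * K\<close> leaves room for \<open>u + A \<le> K + 1\<close>.\<close>
    then have "(A - 2) * (u - 2) \<ge> 0" "(A - 2) * (u - 5) \<ge> 0"
      using \<open>u \<ge> 5\<close> by simp_all
    then have "u + A \<le> K + 1"
      using \<open>A \<ge> 2\<close> \<open>u \<ge> 5\<close> assms(5) mA by (simp add: algebra_simps)
    moreover have "\<not> 3 dvd A"
      using assms(4) mA by auto
    ultimately show ?thesis
      using collision_2_part[of b u A K c] assms(1) mA \<open>odd u\<close> \<open>u \<ge> 5\<close> \<open>A \<ge> 1\<close> by simp
  qed
qed

lemma collision_multiple_of_3:
  fixes b c m :: int and k :: nat
  assumes "even b \<longrightarrow> even c" "m > 0" "3 dvd m" "3 ^ k < m" "m < 3 ^ (k + 1)"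
  shows "collision b c (3 ^ k) m"
proof -
  define e where "e = multiplicity 3 m"
  define w where "w = m div 3 ^ e"
  have m: "m = 3 ^ e * w"
    unfolding w_def e_def by (simp add: multiplicity_dvd)
  have "\<not> 3 dvd m div 3 ^ multiplicity 3 m"
    by (rule multiplicity_decompose) (use assms(2) in auto)
  then have "\<not> 3 dvd w"
    by (simp add: w_def e_def)
  have "w > 0"
    using m assms(2) by (simp add: zero_less_mult_iff)
  have "e \<noteq> 0"
    using m \<open>\<not> 3 dvd w\<close> assms(3) by (intro notI) simp
  have "(3::int) ^ e * 1 \<le> 3 ^ e * w"
    using \<open>w > 0\<close> by (intro mult_left_mono) auto
  then have "(3::int) ^ e < 3 ^ (k + 1)"
    using m assms(5) by linarith
  then have "e < k + 1"
    by (rule power_less_imp_less_exp[rotated]) simp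
  define K F :: int where "K = 3 ^ k" and "F = 3 ^ e"
  have "F \<ge> 3"
    using \<open>e \<noteq> 0\<close> self_le_power[of "3::int" e] by (simp add: F_def)
  have Fw: "m = F * w" "F * w < 3 * K" "K < F * w"
    using assms(4,5) m by (simp_all add: F_def K_def)
  show ?thesis
  proof (cases "e = k")
    \<comment> \<open>Here \<open>m = 2 * K\<close>, and the colliding indices are 0 and
      \<open>K\<close>. The factor 2 divides \<open>c\<close> if \<open>b\<close> is even, and
      \<open>3 * F + b\<close> if \<open>b\<close> is odd.\<close>
    case True
    then have "F = K"
      by (simp add: F_def K_def)
    then have "w < 3" "1 < w"
      using Fw(2,3) \<open>F \<ge> 3\<close> by simp_all
    then have "m = F * 2"
      using Fw(1) by simp
    moreover have "even (c * (3 * F + b))"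
      using assms(1) by (auto simp: F_def)
    then have "F * 2 dvd F * (c * (3 * F + b))"
      by (intro mult_dvd_mono) auto
    moreover have "F * (c * (3 * F + b)) = c * F * (3 * F + b)"
      by (simp only: mult_ac)
    ultimately have "m dvd c * F * (3 * F + b)"
      by simp
    then show ?thesis
      using \<open>F \<ge> 3\<close> \<open>F = K\<close> K_def by (intro collisionI[of F F]) auto
  next
    case False
    then have "Suc e \<le> k"
      using \<open>e < k + 1\<close> by simp
    then have "(3::int) ^ Suc e \<le> 3 ^ k"
      by (rule power_increasing) simp
    then have "3 * F \<le> K"
      by (simp add: F_def K_def)
    \<comment> \<open>If \<open>F = 3\<close>, then \<open>w < K\<close> and
      \<open>K \<ge> 9\<close>. If \<open>F \<ge> 9\<close>, then \<open>w < K / 3\<close>, whereas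
      \<open>4 * F \<le> 4 * K / 3\<close>.\<close>
    have "w \<le> 2 * K - 4 * F + 3"
    proof (cases "e = 1")
      case True
      then show ?thesis
        using Fw(2) \<open>3 * F \<le> K\<close> by (simp add: F_def)
    next
      case False
      then have "(3::int) ^ 2 \<le> 3 ^ e"
        using \<open>e \<noteq> 0\<close> by (intro power_increasing) auto
      then have "9 * w \<le> F * w"
        using \<open>w > 0\<close> by (intro mult_right_mono) (auto simp: F_def)
      then show ?thesis
        using Fw(2) \<open>3 * F \<le> K\<close> \<open>F \<ge> 3\<close> by linarith
    qed
    then have "collision b c K (F * w)"
      using \<open>w > 0\<close> \<open>F \<ge> 3\<close> \<open>\<not> 3 dvd w\<close> by (intro collision_3_part) (auto simp: F_def)
    then show ?thesis
      using Fw(1) by (simp add: K_def)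
  qed
qed

text \<open>Assembles the cases on \<open>m\<close>; \<open>pow2\<close> and \<open>pr\<close> are
  the fourth and fifth conditions of the theorem for the single exponent \<open>k\<close>.\<close>

lemma collision_below_next_power:
  fixes b c m :: int and k :: nat
  assumes nz: "b \<noteq> 0" and b: "b \<ge> -2" and nb: "\<not> 3 dvd b"
    and par: "even b \<longrightarrow> even c"
    and pow2: "\<And>x. \<lbrakk>odd b; x > 0; k > 0; 2 * 3 ^ k < (2::int) ^ x; (2::int) ^ x < 3 ^ (k + 1);
        2 ^ x \<le> \<bar>b\<bar>; 3 dvd b mod 2 ^ x\<rbrakk> \<Longrightarrow> even c"
    and pr: "\<And>p. \<lbrakk>prime p; k > 0; 2 * 3 ^ k < p; p < 3 ^ (k + 1);
        p \<le> \<bar>b\<bar>; 3 dvd b mod p\<rbrakk> \<Longrightarrow> p dvd c"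
    and m: "m > 0" "m < 3 ^ (k + 1)"
  shows "collision b c (3 ^ k) m"
proof -
  define K :: int where "K = 3 ^ k"
  have "K \<ge> 1" "m < 3 * K" "odd K"
    using m(2) by (simp_all add: K_def)
  consider "m \<le> K" | "m > K" "3 dvd m" | "\<not> 3 dvd m" "m \<le> 2 * K - 1" | "m = 2 * K" "\<not> 3 dvd m"
    | (even_c) "\<not> 3 dvd m" "even m" "even c"
    | (big) "m > 2 * K" "\<not> 3 dvd m" "\<not> (even m \<and> even c)"
    by linarith
  then have "collision b c K m"
  proof cases
    case 1
    \<comment> \<open>The indices 0 and \<open>m\<close> collide.\<close>
    then have "m dvd c * (m - 0) * (3 * (0 + m) + b)"
      by simp
    then show ?thesis
      unfolding collision_def using 1 m(1) by blast
  next
    case 2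
    then show ?thesis
      using collision_multiple_of_3[OF par m(1)] m(2) by (simp add: K_def)
  next
    case 3
    then show ?thesis
      using collision_3_part[of 1 m K b c] m(1) by simp
  next
    case 4
    \<comment> \<open>For \<open>k > 0\<close> the number \<open>2 * K\<close> would be a multiple
      of 3.\<close>
    then have "k = 0"
      by (intro ccontr[of "k = 0"]) (auto simp: K_def)
    then have "K = 1" "m = 2"
      using 4 by (simp_all add: K_def)
    then show ?thesis
      using par by (intro collisionI[of 1 1]) auto
  next
    case even_c
    obtain n where n: "m = 2 * n"
      using even_c(2) by (elim evenE)
    have "\<not> 3 dvd n"
      using n even_c(1) by auto
    then have "coprime 3 n"
      using coprime_3_iff by blast
    then obtain s where s: "1 \<le> s" "s < 1 + n" "n dvd 3 * s + b"
      using linear_root_in_interval[of 3 n 1 b] n m(1) by auto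
    have "m dvd c * (3 * s + b)"
      unfolding n using even_c(3) s(3) by (rule mult_dvd_mono)
    then show ?thesis
      using s n \<open>m < 3 * K\<close> by (intro collision_small_root[of s]) auto
  next
    case big
    have "k > 0"
      using big(1) \<open>m < 3 * K\<close> by (intro gr0I) (simp add: K_def)
    have "m > 2"
      using big(1) \<open>K \<ge> 1\<close> by simp
    show ?thesis
    proof (cases "m \<le> \<bar>b\<bar> \<and> 3 dvd b mod m")
      case False
      then show ?thesis
        using nb b nz par big(2,3) \<open>m > 2\<close> \<open>m < 3 * K\<close> \<open>odd K\<close>
        by (intro collision_coprime_3) auto
    next
      case True
      consider (even_m) "even m" "odd c" "\<nexists>x. m = 2 ^ x"
        | (power) x where "even m" "odd c" "m = 2 ^ x"
        | (prime) "odd m" "prime m" | (composite) "odd m" "\<not> prime m"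
        using big(3) by blast
      then show ?thesis
      proof cases
        case even_m
        then show ?thesis
          using par m(1) big(2) \<open>m < 3 * K\<close> by (intro collision_even) auto
      next
        case power
        then have "x > 0"
          using \<open>m > 2\<close> by (intro gr0I) simp
        then have "even c"
          using pow2[of x] par power big \<open>k > 0\<close> m(2) True by (auto simp: K_def)
        then show ?thesis
          using power by simp
      next
        case prime
        then have "m dvd c"
          using pr[of m] big \<open>k > 0\<close> m(2) True by (auto simp: K_def)
        then show ?thesis
          using \<open>K \<ge> 1\<close> by (intro collision_small_root[of 1]) auto
      next
        case composite
        then obtain u v where uv: "m = u * v" "u \<ge> 5" "v \<ge> 5" "odd u" "odd v" "\<not> 3 dvd v"
          using odd_composite_factors[of m] \<open>m > 2\<close> big(2) by auto
        \<comment> \<open>With both factors at least 5, \<open>u + v \<le> m / 5 + 5\<close>. This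
          fits below \<open>K + 1\<close> once \<open>K \<ge> 9\<close>, which follows from
          \<open>25 \<le> m < 3 * K\<close>.\<close>
        have "(u - 5) * (v - 5) \<ge> 0"
          using uv by simp
        then have "5 * u + 5 * v \<le> m + 25"
          using uv(1) by (simp add: algebra_simps)
        moreover have "5 * 5 \<le> u * v"
          using uv by (intro mult_mono) auto
        then have "K \<ge> 9"
          using uv(1) \<open>m < 3 * K\<close> by simp
        ultimately have "u + v \<le> K + 1"
          using \<open>m < 3 * K\<close> by linarith
        then show ?thesis
          unfolding uv(1) using uv by (intro collision_odd_factor) auto
      qed
    qed
  qed
  then show ?thesis
    by (simp add: K_def)
qed

section \<open>Injectivity modulo powers of 3\<close>

lemma quadratic_inj_mod_3_power:
  fixes b c :: int and i j e :: nat
  assumes "\<not> 3 dvd b * c" "i < 3 ^ e" "j < 3 ^ e"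
    and "[3 * c * (int i)\<^sup>2 + b * c * int i = 3 * c * (int j)\<^sup>2 + b * c * int j] (mod 3 ^ e)"
  shows "i = j"
proof -
  have "3 * c * (int i)\<^sup>2 + b * c * int i - (3 * c * (int j)\<^sup>2 + b * c * int j)
      = c * (3 * (int i + int j) + b) * (int i - int j)"
    by (simp add: algebra_simps power2_eq_square)
  then have "3 ^ e dvd c * (3 * (int i + int j) + b) * (int i - int j)"
    using assms(4) by (simp add: cong_iff_dvd_diff)
  moreover have "\<not> 3 dvd c" "\<not> 3 dvd 3 * (int i + int j) + b"
    using assms(1) by (auto simp: dvd_add_right_iff)
  then have "coprime (3 ^ e) (c * (3 * (int i + int j) + b))"
    by (simp only: coprime_mult_right_iff) (simp add: coprime_3_iff coprime_power_left_iff)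
  ultimately have "3 ^ e dvd int i - int j"
    by (simp add: coprime_dvd_mult_right_iff)
  then have "[int i = int j] (mod int (3 ^ e))"
    by (simp add: cong_iff_dvd_diff)
  then have "[i = j] (mod 3 ^ e)"
    by (simp only: cong_int_iff)
  then show ?thesis
    using assms(2,3) by (simp add: cong_less_modulus_unique_nat)
qed

section \<open>The exponent of 3 and the discriminator\<close>

lemma ceiling_log_3_bounds:
  fixes n :: nat
  assumes "n \<ge> 1" and e: "e = nat \<lceil>log 3 (real n)\<rceil>"
  shows "n \<le> 3 ^ e" and "e > 0 \<Longrightarrow> 3 ^ (e - 1) < n"
proof -
  have "log 3 (real n) \<le> real e"
    unfolding e by (rule real_nat_ceiling_ge)
  then have "real n \<le> 3 powr real e"
    using assms(1) by (simp add: log_le_iff)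
  then have "real n \<le> real (3 ^ e)"
    by (simp add: powr_realpow)
  then show "n \<le> 3 ^ e"
    by (simp only: of_nat_le_iff)
  assume "e > 0"
  \<comment> \<open>For \<open>e > 0\<close> neither \<open>nat\<close> nor the subtraction
    truncates, so \<open>e - 1\<close> is the ceiling minus 1.\<close>
  then have "real (e - 1) < log 3 (real n)"
    unfolding e by linarith
  then have "3 powr real (e - 1) < real n"
    using assms(1) by (simp add: less_log_iff)
  then have "real (3 ^ (e - 1)) < real n"
    by (simp add: powr_realpow)
  then show "3 ^ (e - 1) < n"
    by (simp only: of_nat_less_iff)
qed

theorem theorem24:
  fixes b c :: int
  assumes "b \<noteq> 0" and "c \<noteq> 0"
    and "b \<ge> -2"
    and "\<not> 3 dvd b * c"
    and "even b \<longrightarrow> even c"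
    and "odd b \<and>
         (\<exists>x k :: nat. x > 0 \<and> k > 0 \<and>
            2 * 3 ^ k < (2 ^ x :: int) \<and> (2 ^ x :: int) < 3 ^ (k + 1) \<and>
            2 ^ x \<le> \<bar>b\<bar> \<and> [b mod 2 ^ x = 0] (mod 3))
         \<longrightarrow> even c"
    and "\<forall>p :: int. prime p \<and>
         (\<exists>k :: nat. k > 0 \<and> 2 * 3 ^ k < p \<and> p < 3 ^ (k + 1)) \<and>
         p \<le> \<bar>b\<bar> \<and> [b mod p = 0] (mod 3)
         \<longrightarrow> p dvd c"
  shows "\<forall>n :: nat. n \<ge> 1 \<longrightarrow>
    discriminator (\<lambda>i. 3 * c * (int i)\<^sup>2 + b * c * int i) n = 3 ^ nat \<lceil>log 3 (real n)\<rceil>"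
proof (intro allI impI)
  fix n :: nat
  assume "n \<ge> 1"
  define e where "e = nat \<lceil>log 3 (real n)\<rceil>"
  note n = ceiling_log_3_bounds[OF \<open>n \<ge> 1\<close> e_def]
  let ?q = "\<lambda>i::nat. 3 * c * (int i)\<^sup>2 + b * c * int i"
  have "discriminator ?q n = 3 ^ e"
    unfolding discriminator_def
  proof (rule Least_equality, intro conjI allI impI notI)
    fix i j
    assume "i < n" "j < n" "i \<noteq> j" "[?q i = ?q j] (mod int (3 ^ e))"
    then show False
      using quadratic_inj_mod_3_power[OF assms(4), of i e j] n(1) by simp
  next
    fix m :: nat
    assume m: "m > 0 \<and> (\<forall>i<n. \<forall>j<n. i \<noteq> j \<longrightarrow> \<not> [?q i = ?q j] (mod int m))"
    show "3 ^ e \<le> m"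
    proof (rule ccontr)
      assume "\<not> 3 ^ e \<le> m"
      then have "m < 3 ^ e"
        by simp
      then have "e > 0"
        using m by (intro gr0I) simp
      then obtain k where k: "e = k + 1"
        by (metis Suc_eq_plus1 gr0_implies_Suc)
      have "int m < int (3 ^ e)"
        using \<open>m < 3 ^ e\<close> by (simp only: of_nat_less_iff)
      then have "int m < 3 ^ (k + 1)"
        by (simp add: k)
      moreover have "even c" if "odd b" "x > 0" "k > 0" "2 * 3 ^ k < (2::int) ^ x"
        "(2::int) ^ x < 3 ^ (k + 1)" "2 ^ x \<le> \<bar>b\<bar>" "3 dvd b mod 2 ^ x" for x
        using assms(6) that unfolding cong_0_iff by blast
      moreover have "p dvd c" if "prime p" "k > 0" "2 * 3 ^ k < p" "p < 3 ^ (k + 1)"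
        "p \<le> \<bar>b\<bar>" "3 dvd b mod p" for p
        using assms(7) that unfolding cong_0_iff by blast
      moreover have "\<not> 3 dvd b" "int m > 0"
        using assms(4) m by auto
      ultimately have "collision b c (3 ^ k) (int m)"
        using assms(1,3,5) by (intro collision_below_next_power) blast+
      then obtain i j where ij: "0 \<le> i" "i < j" "j \<le> 3 ^ k"
        "int m dvd c * (j - i) * (3 * (i + j) + b)"
        unfolding collision_def by blast
      have "?q (nat j) - ?q (nat i) = c * (j - i) * (3 * (i + j) + b)"
        using ij by (simp add: algebra_simps power2_eq_square)
      then have cong: "[?q (nat j) = ?q (nat i)] (mod int m)"
        using ij(4) by (simp add: cong_iff_dvd_diff)
      \<comment> \<open>The index \<open>3 ^ k\<close> itself is available because
        \<open>3 ^ (e - 1) < n\<close> is strict.\<close>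
      have "nat j \<le> 3 ^ k"
        using ij(3) by (simp add: nat_le_iff)
      also have "\<dots> < n"
        using n(2) k by simp
      finally have "nat j < n" .
      moreover have "nat i < nat j"
        using ij by simp
      ultimately have "nat i < n" "nat j < n" "nat j \<noteq> nat i"
        by auto
      then show False
        using m cong by blast
    qed
  qed simp
  then show "discriminator ?q n = 3 ^ nat \<lceil>log 3 (real n)\<rceil>"
    by (simp add: e_def)
qed

end
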